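(* Let $G$ be any graph on $n\ge 3$ vertices. Then $\mathrm{Rs}(G)\ge \max\{\mathrm{R}(G),\,(n-1)^2+1\}$.
   Context: All graphs are finite and simple; isolated vertices of $G$ are counted as vertices of $G$. A (not necessarily induced) subgraph $H$ of a host graph $F$ is singular if the degrees $d_F(v)$, $v\in V(H)$, taken in $F$, are all equal or pairwise distinct. In an edge 2-coloring of $K_m$, the host graph of a color is the spanning graph on all $m$ vertices formed by the edges of that color. The singular Ramsey number $\mathrm{Rs}(G)$ is the smallest integer $N$ such that for every $m\ge N$ and every 2-coloring of the edges of $K_m$, at least one of the two color graphs contains a singular subgraph isomorphic to $G$. $\mathrm{R}(G)$ is the ordinary (2-color, diagonal) Ramsey number of $G$: the smallest $N$ such that every 2-coloring of the edges of $K_N$ contains a monochromatic copy of $G$. *)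

theory Defs
  imports Main "HOL-Library.Ramsey"
begin

type_synonym 'a graph = "'a set \<times> 'a set set"

abbreviation verts :: "'a graph \<Rightarrow> 'a set" where
  "verts G \<equiv> fst G"

abbreviation edges :: "'a graph \<Rightarrow> 'a set set" where
  "edges G \<equiv> snd G"

definition simple_graph :: "'a graph \<Rightarrow> bool" where
  "simple_graph G \<longleftrightarrow> finite (verts G) \<and> edges G \<subseteq> [verts G]\<^bsup>2\<^esup>"

definition degree :: "'a graph \<Rightarrow> 'a \<Rightarrow> nat" where
  "degree G v = card {e \<in> edges G. v \<in> e}"

definition subgraph :: "'a graph \<Rightarrow> 'a graph \<Rightarrow> bool" where
  "subgraph H F \<longleftrightarrow> simple_graph H \<and> verts H \<subseteq> verts F \<and> edges H \<subseteq> edges F"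

definition graph_iso :: "'a graph \<Rightarrow> 'b graph \<Rightarrow> bool" where
  "graph_iso G H \<longleftrightarrow> (\<exists>f. bij_betw f (verts G) (verts H) \<and>
     (\<forall>u\<in>verts G. \<forall>v\<in>verts G. {u, v} \<in> edges G \<longleftrightarrow> {f u, f v} \<in> edges H))"

text \<open>The degrees are those in the host graph \<open>F\<close>, not those in \<open>H\<close>.\<close>

definition singular_in :: "'a graph \<Rightarrow> 'a graph \<Rightarrow> bool" where
  "singular_in F H \<longleftrightarrow>
     (\<forall>u\<in>verts H. \<forall>v\<in>verts H. degree F u = degree F v) \<or> inj_on (degree F) (verts H)"

text \<open>An edge 2-coloring of the complete graph on \<open>{..<m}\<close>.\<close>

definition edge_2_coloring :: "nat \<Rightarrow> (nat set \<Rightarrow> nat) \<Rightarrow> bool" where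
  "edge_2_coloring m c \<longleftrightarrow> c \<in> [{..<m}]\<^bsup>2\<^esup> \<rightarrow> {..<2}"

definition color_graph :: "nat \<Rightarrow> (nat set \<Rightarrow> nat) \<Rightarrow> nat \<Rightarrow> nat graph" where
  "color_graph m c i = ({..<m}, {e \<in> [{..<m}]\<^bsup>2\<^esup>. c e = i})"

definition ramsey_number :: "'a graph \<Rightarrow> nat" where
  "ramsey_number G = (LEAST N. \<forall>c. edge_2_coloring N c \<longrightarrow>
     (\<exists>i<2. \<exists>H. subgraph H (color_graph N c i) \<and> graph_iso G H))"

text \<open>
  The set of admissible \<open>N\<close> is nonempty for every finite simple graph \<open>G\<close>, with or without
  singularity. For the singular version: a vertex of degree \<open>d\<close> in one color has degree
  \<open>m - 1 - d\<close> in the other, so a set of vertices with equal (or distinct) degrees in one color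
  has this property in both. If \<open>r = ramsey_number G\<close> is positive and \<open>m > (r - 1)\<^sup>2\<close>, there is
  such a set of \<open>r\<close> vertices, and Ramsey's theorem applies inside it.
\<close>

definition singular_ramsey_number :: "'a graph \<Rightarrow> nat" where
  "singular_ramsey_number G = (LEAST N. \<forall>m\<ge>N. \<forall>c. edge_2_coloring m c \<longrightarrow>
     (\<exists>i<2. \<exists>H. subgraph H (color_graph m c i) \<and>
        singular_in (color_graph m c i) H \<and> graph_iso G H))"

end

theory Submission
  imports Defs
begin

text \<open>
  The bound by \<open>ramsey_number G\<close> holds because a singular copy is in particular a copy.

  For the quadratic bound put \<open>k = n - 1 \<ge> 2\<close>. It suffices to colour \<open>K\<^bsub>k\<^sup>2\<^esub>\<close> so that each
  colour graph has exactly \<open>k\<close> different degrees and every degree is taken exactly \<open>k\<close> times: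
  then neither \<open>k + 1\<close> vertices of equal degree nor \<open>k + 1\<close> vertices of distinct degrees
  exist. Such a colouring is a blown-up threshold graph. Cut the vertices into \<open>k\<close> blocks
  \<open>0, \<dots>, k - 1\<close> of \<open>k\<close> vertices, and give an edge colour \<open>0\<close> if the numbers of the blocks
  of its two ends add up to at least \<open>k\<close>. A vertex \<open>x\<close> of block \<open>a\<close> then has in colour \<open>0\<close>
  all vertices of the last \<open>a\<close> blocks as neighbours, except itself. Its degree is thus
  \<open>k a\<close> or \<open>k a - 1\<close>, and since \<open>k \<ge> 2\<close> this number determines \<open>a\<close>
  (\<open>degree_block_coloring_eq_iff\<close>). The degrees of a vertex in the two colours have the sum
  \<open>m - 1\<close>, so singularity does not depend on the colour in which the degrees are measured
  (\<open>singular_in_other_color\<close>).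

  As \<open>singular_ramsey_number G\<close> is a least element, neither bound means anything unless some
  \<open>N\<close> has the required property (\<open>ex_singular_ramsey\<close>). For large \<open>m\<close>
  the pigeonhole principle gives a large set of vertices with degrees in colour \<open>0\<close>
  all equal or all distinct. Ramsey's theorem inside this set gives a monochromatic clique on
  \<open>n\<close> vertices. By the remark on degrees, every copy of \<open>G\<close> in this clique is singular in
  the host graph of its own colour.
\<close>


section \<open>Degrees in the two colour graphs\<close>

lemma degree_color_graph:
  assumes "v < m"
  shows "degree (color_graph m c i) v = card {w \<in> {..<m} - {v}. c {v, w} = i}"
proof -
  have "bij_betw (\<lambda>w. {v, w}) {w \<in> {..<m} - {v}. c {v, w} = i}
          {e \<in> edges (color_graph m c i). v \<in> e}"
    using assms
    by (auto simp: bij_betw_def inj_on_def color_graph_def doubleton_eq_iff nsets_2_eq insert_commute)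
  then show ?thesis
    unfolding degree_def by (simp add: bij_betw_same_card)
qed

lemma degree_color_graph_add:
  assumes "edge_2_coloring m c" and "v < m"
  shows "degree (color_graph m c 0) v + degree (color_graph m c 1) v = m - 1"
proof -
  let ?N = "\<lambda>i. {w \<in> {..<m} - {v}. c {v, w} = i}"
  have "c {v, w} < 2" if "w \<in> {..<m} - {v}" for w
    using assms that unfolding edge_2_coloring_def by (auto dest!: funcset_mem[of c _ _ "{v, w}"])
  then have "{..<m} - {v} = ?N 0 \<union> ?N 1"
    by (fastforce simp: less_2_cases_iff)
  moreover have "card (?N 0 \<union> ?N 1) = card (?N 0) + card (?N 1)"
    by (rule card_Un_disjoint) auto
  ultimately have "card (?N 0) + card (?N 1) = card ({..<m} - {v})"
    by metis
  then show ?thesis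
    using assms(2) by (simp add: degree_color_graph card_Diff_singleton)
qed

text \<open>
  By the preceding identity, two vertices have equal degrees in one colour if and only if they
  have equal degrees in the other.
\<close>

lemma singular_in_other_color:
  assumes "edge_2_coloring m c" and "i < 2" and "verts H \<subseteq> {..<m}"
  shows "singular_in (color_graph m c i) H \<longleftrightarrow> singular_in (color_graph m c 0) H"
proof -
  have "degree (color_graph m c i) u = degree (color_graph m c i) v \<longleftrightarrow>
        degree (color_graph m c 0) u = degree (color_graph m c 0) v"
    if "u \<in> verts H" "v \<in> verts H" for u v
  proof -
    have "u < m" "v < m"
      using that assms(3) by auto
    then show ?thesis
      using degree_color_graph_add[OF assms(1), of u] degree_color_graph_add[OF assms(1), of v]
        less_2_cases[OF assms(2)] by fastforce
  qed
  then show ?thesis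
    unfolding singular_in_def inj_on_def by blast
qed


section \<open>Finiteness of the singular Ramsey number\<close>

text \<open>
  If \<open>f\<close> takes at least \<open>r\<close> values, choose one point for each; otherwise the pigeonhole principle
  gives a fibre with at least \<open>r\<close> points.
\<close>

lemma ex_subset_constant_or_inj:
  fixes f :: "'a \<Rightarrow> 'b"
  assumes "finite A" and "r * r \<le> card A"
  obtains S where "S \<subseteq> A" "card S = r" "(\<forall>x\<in>S. \<forall>y\<in>S. f x = f y) \<or> inj_on f S"
proof (cases "r \<le> card (f ` A)")
  case True
  obtain B where B: "B \<subseteq> A" "inj_on f B" "f ` A = f ` B"
    by (meson order_refl subset_image_inj)
  then have "r \<le> card B"
    using True by (simp add: card_image)
  then obtain S where "S \<subseteq> B" "card S = r"
    by (meson obtain_subset_with_card_n)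
  then show thesis
    using that[of S] B inj_on_subset[of f B S] by blast
next
  case False
  then have "A \<noteq> {}"
    using assms(2) by auto
  then obtain y where y: "card A \<le> card (f -` {y} \<inter> A) * card (f ` A)"
    using pigeonhole_card[of f A "f ` A"] assms(1) by auto
  have "r \<le> card (f -` {y} \<inter> A)"
  proof (rule ccontr)
    assume "\<not> ?thesis"
    then have "card (f -` {y} \<inter> A) * card (f ` A) < r * r"
      using False by (intro mult_strict_mono) auto
    then show False
      using y assms(2) by simp
  qed
  then obtain S where "S \<subseteq> f -` {y} \<inter> A" "card S = r"
    by (meson obtain_subset_with_card_n)
  then show thesis
    using that[of S] by blast
qed

text \<open>
  A monochromatic clique contains every graph on as many vertices, as subgraphs need not be
  induced.
\<close>

lemma ex_copy_in_clique:
  fixes G :: "'a graph" and T :: "nat set"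
  assumes "simple_graph G" and "finite T" and "card T = card (verts G)"
    and "T \<subseteq> {..<m}" and mono: "\<And>e. e \<in> [T]\<^bsup>2\<^esup> \<Longrightarrow> c e = i"
  obtains H where "verts H = T" "subgraph H (color_graph m c i)" "graph_iso G H"
proof -
  have fin: "finite (verts G)" and eG: "edges G \<subseteq> [verts G]\<^bsup>2\<^esup>"
    using assms(1) by (auto simp: simple_graph_def)
  obtain f where f: "bij_betw f (verts G) T"
    using finite_same_card_bij fin assms(2,3) by metis
  let ?E = "(`) f ` edges G"
  have "(`) f ` [verts G]\<^bsup>2\<^esup> = [T]\<^bsup>2\<^esup>"
    using bij_betw_nsets[OF f] by (simp add: bij_betw_def)
  then have E: "?E \<subseteq> [T]\<^bsup>2\<^esup>"
    using eG by blast
  have "{f u, f v} \<in> ?E \<longleftrightarrow> {u, v} \<in> edges G" if "u \<in> verts G" "v \<in> verts G" for u v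
  proof
    assume "{f u, f v} \<in> ?E"
    then obtain e where e: "e \<in> edges G" "f ` {u, v} = f ` e"
      by auto
    moreover have "e \<subseteq> verts G"
      using e eG by (auto simp: nsets_def)
    ultimately have "{u, v} = e"
      using f that by (metis bij_betw_imp_inj_on empty_subsetI inj_on_image_eq_iff insert_subset)
    then show "{u, v} \<in> edges G"
      using e by simp
  next
    assume "{u, v} \<in> edges G"
    then show "{f u, f v} \<in> ?E"
      by (metis image_empty image_insert image_eqI)
  qed
  then have "graph_iso G (T, ?E)"
    using f unfolding graph_iso_def fst_conv snd_conv by blast
  moreover have "subgraph (T, ?E) (color_graph m c i)"
    using E assms(2,4) mono nsets_mono[OF assms(4), of 2]
    unfolding subgraph_def simple_graph_def color_graph_def by auto
  ultimately show thesis
    using that[of "(T, ?E)"] by simp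
qed

text \<open>
  Degrees are controlled first: inside a set where they are all equal or all distinct, Ramsey's
  theorem may choose any clique. This set depends on the degrees in colour \<open>0\<close> only, although
  the colour of the clique is not known in advance.
\<close>

lemma ex_singular_ramsey:
  fixes G :: "'a graph"
  assumes "simple_graph G"
  shows "\<exists>N. \<forall>m\<ge>N. \<forall>c. edge_2_coloring m c \<longrightarrow>
     (\<exists>i<2. \<exists>H. subgraph H (color_graph m c i) \<and>
        singular_in (color_graph m c i) H \<and> graph_iso G H)"
proof -
  define n where "n = card (verts G)"
  obtain r where r: "\<And>(V::nat set) E. finite V \<Longrightarrow> card V \<ge> r \<Longrightarrow>
      \<exists>R\<subseteq>V. card R = n \<and> clique R E \<or> card R = n \<and> indep R E"
    using ramsey2[of n n] by metis
  have "\<exists>i<2. \<exists>H. subgraph H (color_graph m c i) \<and>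
        singular_in (color_graph m c i) H \<and> graph_iso G H"
    if "r * r \<le> m" and c: "edge_2_coloring m c" for m c
  proof -
    let ?d = "degree (color_graph m c 0)"
    obtain S where S: "S \<subseteq> {..<m}" "card S = r"
      "(\<forall>x\<in>S. \<forall>y\<in>S. ?d x = ?d y) \<or> inj_on ?d S"
      by (rule ex_subset_constant_or_inj[of "{..<m}" r ?d]) (use \<open>r * r \<le> m\<close> in simp_all)
    have "finite S"
      using S finite_subset by blast
    then obtain T where T: "T \<subseteq> S" "card T = n" "clique T {e. c e = 0} \<or> indep T {e. c e = 0}"
      using r[of S "{e. c e = 0}"] S by auto
    have "T \<subseteq> {..<m}" "finite T"
      using S T \<open>finite S\<close> finite_subset by blast+
    have "c e < 2" if "e \<in> [T]\<^bsup>2\<^esup>" for e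
      using c that nsets_mono[OF \<open>T \<subseteq> {..<m}\<close>] unfolding edge_2_coloring_def by blast
    then obtain i where i: "i < 2" "\<And>e. e \<in> [T]\<^bsup>2\<^esup> \<Longrightarrow> c e = i"
    proof (cases "clique T {e. c e = 0}")
      case True
      then have "c e = 0" if "e \<in> [T]\<^bsup>2\<^esup>" for e
        using that by (auto simp: clique_def elim!: nsets2_E)
      then show thesis
        using that[of 0] by simp
    next
      case False
      then have "c e \<noteq> 0" if "e \<in> [T]\<^bsup>2\<^esup>" for e
        using T(3) that by (auto simp: indep_def elim!: nsets2_E)
      then show thesis
        using that[of 1] \<open>\<And>e. e \<in> [T]\<^bsup>2\<^esup> \<Longrightarrow> c e < 2\<close> by (fastforce simp: less_2_cases_iff)
    qed
    obtain H where H: "verts H = T" "subgraph H (color_graph m c i)" "graph_iso G H"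
      by (rule ex_copy_in_clique[where c = c, OF assms \<open>finite T\<close> _ \<open>T \<subseteq> {..<m}\<close>])
        (use i(2) T(2) n_def in simp_all)
    have "singular_in (color_graph m c 0) H"
      using S(3) T(1) H(1) unfolding singular_in_def by (meson inj_on_subset subsetD)
    then have "singular_in (color_graph m c i) H"
      using singular_in_other_color[OF c i(1)] H(1) \<open>T \<subseteq> {..<m}\<close> by simp
    then show ?thesis
      using i(1) H by blast
  qed
  then show ?thesis
    by blast
qed


section \<open>A colouring with few degrees, each taken few times\<close>

text \<open>
  The blown-up threshold graph, with block numbers \<open>x div k\<close>. The condition \<open>a + b \<ge> k\<close> also
  applies to the edges inside one block, so that the blocks \<open>a \<ge> k / 2\<close> are cliques. This
  separates the degrees in the last block below \<open>k / 2\<close> and in the first clique, which would be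
  equal if all blocks were independent.
\<close>

definition block_coloring :: "nat \<Rightarrow> nat set \<Rightarrow> nat" where
  "block_coloring k e = (if k \<le> (\<Sum>x\<in>e. x div k) then 0 else 1)"

lemma edge_2_coloring_block_coloring: "edge_2_coloring m (block_coloring k)"
  by (auto simp: edge_2_coloring_def block_coloring_def)

text \<open>
  The neighbours of \<open>x\<close> are the vertices of the last \<open>x div k\<close> blocks, which form a final
  interval of the vertex set; \<open>x\<close> itself must be left out if it lies in this interval.
\<close>

lemma degree_block_coloring:
  assumes "x < k\<^sup>2"
  shows "degree (color_graph (k\<^sup>2) (block_coloring k) 0) x =
    k * (x div k) - (if k \<le> x div k + x div k then 1 else 0)"
proof -
  have k: "0 < k" and a: "x div k < k"
    using assms by (auto simp: power2_eq_square less_mult_imp_div_less intro: Nat.gr0I)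
  let ?s = "k * (k - x div k)"
  have last_blocks: "k \<le> x div k + y div k \<longleftrightarrow> ?s \<le> y" for y
    using less_eq_div_iff_mult_less_eq[OF k, of "k - x div k" y]
    by (simp add: mult.commute le_diff_conv add.commute)
  have "{w \<in> {..<k\<^sup>2} - {x}. block_coloring k {x, w} = 0} = {?s..<k\<^sup>2} - {x}"
    by (auto simp: block_coloring_def last_blocks)
  then have "degree (color_graph (k\<^sup>2) (block_coloring k) 0) x = card ({?s..<k\<^sup>2} - {x})"
    using degree_color_graph[OF assms] by simp
  also have "\<dots> = card {?s..<k\<^sup>2} - (if ?s \<le> x then 1 else 0)"
    using assms by (auto simp: card_Diff_singleton_if)
  also have "card {?s..<k\<^sup>2} = k * (x div k)"
    using a by (simp add: power2_eq_square diff_mult_distrib2)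
  finally show ?thesis
    by (simp only: last_blocks)
qed

text \<open>
  From one block to the next, \<open>k (x div k)\<close> grows by \<open>k \<ge> 2\<close>, and the correction is at most
  \<open>1\<close>, so the degree grows strictly.
\<close>

lemma degree_block_coloring_eq_iff:
  assumes "2 \<le> k" and "x < k\<^sup>2" and "y < k\<^sup>2"
  shows "degree (color_graph (k\<^sup>2) (block_coloring k) 0) x =
         degree (color_graph (k\<^sup>2) (block_coloring k) 0) y \<longleftrightarrow> x div k = y div k"
proof -
  let ?g = "\<lambda>a. k * a - (if k \<le> a + a then 1 else 0)"
  have "strict_mono ?g"
    using assms(1) by (auto simp: strict_mono_Suc_iff)
  then show ?thesis
    using degree_block_coloring[OF assms(2)] degree_block_coloring[OF assms(3)]
      strict_mono_eq[of ?g "x div k" "y div k"] by simp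
qed

lemma card_singular_block_coloring:
  assumes "2 \<le> k" and "i < 2" and "verts H \<subseteq> {..<k\<^sup>2}"
    and "singular_in (color_graph (k\<^sup>2) (block_coloring k) i) H"
  shows "card (verts H) \<le> k"
proof -
  let ?d = "degree (color_graph (k\<^sup>2) (block_coloring k) 0)"
  have eq_iff: "?d x = ?d y \<longleftrightarrow> x div k = y div k" if "x \<in> verts H" "y \<in> verts H" for x y
    using degree_block_coloring_eq_iff[OF assms(1)] that assms(3) by blast
  have "singular_in (color_graph (k\<^sup>2) (block_coloring k) 0) H"
    using assms singular_in_other_color[OF edge_2_coloring_block_coloring] by blast
  then consider "\<forall>x\<in>verts H. \<forall>y\<in>verts H. x div k = y div k" | "inj_on (\<lambda>x. x div k) (verts H)"
    unfolding singular_in_def inj_on_def using eq_iff by metis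
  then show ?thesis
  proof cases
    case 1
    \<comment> \<open>Inside one block the residue modulo \<open>k\<close> identifies the vertex.\<close>
    have "inj_on (\<lambda>x. x mod k) (verts H)"
      by (rule inj_onI) (metis 1 div_mult_mod_eq)
    moreover have "(\<lambda>x. x mod k) ` verts H \<subseteq> {..<k}"
      using assms(1) by auto
    ultimately show ?thesis
      using card_inj_on_le[of "\<lambda>x. x mod k" "verts H" "{..<k}"] by simp
  next
    case 2
    have "(\<lambda>x. x div k) ` verts H \<subseteq> {..<k}"
      using assms(3) by (auto simp: power2_eq_square less_mult_imp_div_less)
    then show ?thesis
      using card_inj_on_le[OF 2, of "{..<k}"] by simp
  qed
qed


section \<open>The lower bound\<close>

theorem theorem13:
  fixes G :: "'a graph" and n :: nat
  assumes "simple_graph G"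
    and "card (verts G) = n"
    and "n \<ge> 3"
  shows "singular_ramsey_number G \<ge> max (ramsey_number G) ((n - 1)\<^sup>2 + 1)"
proof -
  let ?N = "singular_ramsey_number G"
  have N: "\<exists>i<2. \<exists>H. subgraph H (color_graph m c i) \<and>
      singular_in (color_graph m c i) H \<and> graph_iso G H"
    if "?N \<le> m" "edge_2_coloring m c" for m c
    using LeastI_ex[OF ex_singular_ramsey[OF assms(1)]] that
    unfolding singular_ramsey_number_def by blast
  have "ramsey_number G \<le> ?N"
    unfolding ramsey_number_def by (rule Least_le) (use N in blast)
  moreover have "(n - 1)\<^sup>2 < ?N"
  proof (rule ccontr)
    assume "\<not> (n - 1)\<^sup>2 < ?N"
    then obtain i H where H: "i < 2"
      "subgraph H (color_graph ((n - 1)\<^sup>2) (block_coloring (n - 1)) i)"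
      "singular_in (color_graph ((n - 1)\<^sup>2) (block_coloring (n - 1)) i) H" "graph_iso G H"
      using N[OF _ edge_2_coloring_block_coloring] by (meson not_less)
    have "verts H \<subseteq> {..<(n - 1)\<^sup>2}"
      using H(2) by (simp add: subgraph_def color_graph_def)
    then have "card (verts H) \<le> n - 1"
      using card_singular_block_coloring H(1,3) assms(3) by simp
    moreover have "card (verts H) = n"
      using H(4) assms(2) bij_betw_same_card unfolding graph_iso_def by metis
    ultimately show False
      using assms(3) by simp
  qed
  ultimately show ?thesis
    by simp
qed

end
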